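(* Let $n$ be a positive integer. If there exists a Kirkman frame of type $6^n$ which contains as a subdesign a $3$-GDD of type $3^n$, then there exists a Kirkman triple system of order $6n+3$ which contains as a subdesign a Steiner triple system of order $3n$.
   Context: An STS$(v)$ is a set of $v$ points with a set of 3-subsets (blocks) such that each pair of distinct points lies in exactly one block; a KTS$(v)$ is an STS$(v)$ whose blocks partition into parallel classes (partitions of the point set); a subdesign is a subset of points with a subset of blocks forming an STS on that subset. A 3-GDD of type $g^u$ on a point set $V$ is a partition of $V$ into $u$ groups of size $g$ with a set of 3-subset blocks, each meeting every group in at most one point, such that any two points in different groups lie in exactly one block. A Kirkman frame is a 3-GDD whose blocks can be partitioned into partial parallel classes, each a partition of $V\setminus V_i$ for some group $V_i$. A Kirkman frame of type $h^u$ (groups $V_i$, blocks $\mathcal{B}$) contains a 3-GDD of type $g^u$ (groups $W_i$, blocks $\mathcal{A}$) as a subdesign if $W_i\subseteq V_i$ for all $i$ and $\mathcal{A}\subseteq\mathcal{B}$. *)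

theory Defs
  imports "HOL-Library.Disjoint_Sets"
begin

text \<open>
  A design is given by its point set and its set of blocks. The predicate \<open>partition_on\<close>
  requires the parts to be nonempty, pairwise disjoint and to cover the set.
\<close>

definition steiner_triple_system :: "nat \<Rightarrow> 'a set \<Rightarrow> 'a set set \<Rightarrow> bool" where
  "steiner_triple_system v V B \<longleftrightarrow>
     finite V \<and> card V = v \<and>
     (\<forall>b\<in>B. b \<subseteq> V \<and> card b = 3) \<and>
     (\<forall>x\<in>V. \<forall>y\<in>V. x \<noteq> y \<longrightarrow> (\<exists>!b. b \<in> B \<and> x \<in> b \<and> y \<in> b))"

definition parallel_class :: "'a set \<Rightarrow> 'a set set \<Rightarrow> bool" where
  "parallel_class V P \<longleftrightarrow> partition_on V P"

definition kirkman_triple_system :: "nat \<Rightarrow> 'a set \<Rightarrow> 'a set set \<Rightarrow> bool" where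
  "kirkman_triple_system v V B \<longleftrightarrow>
     steiner_triple_system v V B \<and>
     (\<exists>R. partition_on B R \<and> (\<forall>P\<in>R. parallel_class V P))"

definition sts_subdesign ::
  "nat \<Rightarrow> 'a set \<Rightarrow> 'a set set \<Rightarrow> 'a set \<Rightarrow> 'a set set \<Rightarrow> bool" where
  "sts_subdesign w W A V B \<longleftrightarrow>
     W \<subseteq> V \<and> A \<subseteq> B \<and> steiner_triple_system w W A"

text \<open>
  In \<open>three_gdd g u V G B\<close>, a 3-GDD of type \<open>g\<^sup>u\<close>, the groups are the sets \<open>G i\<close> for \<open>i < u\<close>;
  the values of \<open>G\<close> at other indices are irrelevant.
\<close>

definition three_gdd ::
  "nat \<Rightarrow> nat \<Rightarrow> 'a set \<Rightarrow> (nat \<Rightarrow> 'a set) \<Rightarrow> 'a set set \<Rightarrow> bool" where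
  "three_gdd g u V G B \<longleftrightarrow>
     finite V \<and> (\<Union>i<u. G i) = V \<and> disjoint_family_on G {..<u} \<and>
     (\<forall>i<u. card (G i) = g) \<and>
     (\<forall>b\<in>B. b \<subseteq> V \<and> card b = 3 \<and> (\<forall>i<u. card (b \<inter> G i) \<le> 1)) \<and>
     (\<forall>i<u. \<forall>j<u. i \<noteq> j \<longrightarrow>
        (\<forall>x\<in>G i. \<forall>y\<in>G j. \<exists>!b. b \<in> B \<and> x \<in> b \<and> y \<in> b))"

definition kirkman_frame ::
  "nat \<Rightarrow> nat \<Rightarrow> 'a set \<Rightarrow> (nat \<Rightarrow> 'a set) \<Rightarrow> 'a set set \<Rightarrow> bool" where
  "kirkman_frame h u V G B \<longleftrightarrow>
     three_gdd h u V G B \<and>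
     (\<exists>R. partition_on B R \<and> (\<forall>P\<in>R. \<exists>i<u. partition_on (V - G i) P))"

text \<open>
  The frame and the subdesign have the same number \<open>u\<close> of groups, and their groups correspond
  index by index. The point set of the subdesign is the union of its groups.
\<close>

definition gdd_subdesign ::
  "nat \<Rightarrow> nat \<Rightarrow> (nat \<Rightarrow> 'a set) \<Rightarrow> 'a set set \<Rightarrow> (nat \<Rightarrow> 'a set) \<Rightarrow> 'a set set \<Rightarrow> bool" where
  "gdd_subdesign g u W A G B \<longleftrightarrow>
     three_gdd g u (\<Union>i<u. W i) W A \<and> (\<forall>i<u. W i \<subseteq> G i) \<and> A \<subseteq> B"

end

theory Submission imports Defs begin

text \<open>
  If there is more than one group, counting the blocks through a point shows that exactly three
  partial parallel classes of the frame miss each group \<open>G i\<close>. Add three points \<open>I\<close> and put on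
  each \<open>G i \<union> I\<close> a KTS(9) in which \<open>{I, W i, G i - W i}\<close> is a parallel class. The other three
  classes of that KTS(9) complete the three partial classes missing \<open>G i\<close>, and the classes
  \<open>{I, W i, G i - W i}\<close> together form one more parallel class. The sets \<open>W i\<close> are now blocks,
  and they fill the groups of the 3-GDD of type \<open>3\<^sup>n\<close>, which gives the STS(3n).
\<close>

section \<open>Transport of partitions and Steiner triple systems along injections\<close>

lemma partition_on_image:
  assumes "partition_on V P" "inj_on f V"
  shows "partition_on (f ` V) ((`) f ` P)"
proof -
  have "{} \<notin> (`) f ` P"
    using partition_onD3[OF assms(1)] by auto
  then show ?thesis
    using partition_on_inj_image[OF assms] by simp
qed

text \<open>Since \<open>f\<close> is injective on \<open>V\<close>, a point lies in a block exactly
  when its image lies in the image of the block, so the unique block through a pair stays unique.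
  This carries the system of order 9 on numbers over to arbitrary points.\<close>

lemma steiner_triple_system_image:
  assumes sts: "steiner_triple_system v V B" and inj: "inj_on f V"
  shows "steiner_triple_system v (f ` V) ((`) f ` B)"
proof -
  have sub: "b \<subseteq> V" if "b \<in> B" for b
    using sts that unfolding steiner_triple_system_def by blast
  have mem: "f x \<in> f ` b \<longleftrightarrow> x \<in> b" if "b \<in> B" "x \<in> V" for b x
    using inj sub[OF that(1)] that(2) by (simp add: inj_on_image_mem_iff)
  have pair: "\<exists>!c. c \<in> (`) f ` B \<and> f x \<in> c \<and> f y \<in> c"
    if "x \<in> V" "y \<in> V" "x \<noteq> y" for x y
  proof -
    have "\<exists>!b. b \<in> B \<and> x \<in> b \<and> y \<in> b"
      using sts that unfolding steiner_triple_system_def by blast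
    then obtain b where "b \<in> B" "x \<in> b" "y \<in> b"
      and uniq: "\<And>c. c \<in> B \<Longrightarrow> x \<in> c \<Longrightarrow> y \<in> c \<Longrightarrow> c = b" by blast
    show ?thesis
    proof (rule ex1I[of _ "f ` b"])
      show "f ` b \<in> (`) f ` B \<and> f x \<in> f ` b \<and> f y \<in> f ` b"
        using \<open>b \<in> B\<close> \<open>x \<in> b\<close> \<open>y \<in> b\<close> by blast
      fix c assume c: "c \<in> (`) f ` B \<and> f x \<in> c \<and> f y \<in> c"
      then obtain d where "d \<in> B" "c = f ` d" by blast
      then show "c = f ` b" using mem[of d] c that(1,2) uniq[of d] by simp
    qed
  qed
  have "\<exists>!c. c \<in> (`) f ` B \<and> x \<in> c \<and> y \<in> c"
    if xy: "x \<in> f ` V" "y \<in> f ` V" "x \<noteq> y" for x y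
  proof -
    obtain x' y' where *: "x = f x'" "y = f y'" "x' \<in> V" "y' \<in> V" using xy(1,2) by blast
    then have "x' \<noteq> y'" using xy(3) by blast
    then show ?thesis unfolding *(1,2) by (rule pair[OF *(3,4)])
  qed
  moreover have "card (f ` V) = v" "finite (f ` V)"
    using sts inj by (auto simp: steiner_triple_system_def card_image)
  moreover have "c \<subseteq> f ` V \<and> card c = 3" if "c \<in> (`) f ` B" for c
  proof -
    obtain b where b: "b \<in> B" "c = f ` b" using \<open>c \<in> (`) f ` B\<close> by blast
    have "card (f ` b) = card b"
      by (rule card_image[OF inj_on_subset[OF inj sub[OF b(1)]]])
    moreover have "card b = 3" using sts b(1) by (simp add: steiner_triple_system_def)
    ultimately show ?thesis using b(2) sub[OF b(1)] by (simp add: image_mono)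
  qed
  ultimately show ?thesis
    by (simp add: steiner_triple_system_def)
qed

text \<open>Serves two changes of representation of parallel classes: from lists to sets of points
  (\<open>g\<close> is \<open>set\<close>), and from sets of numbers to their images under a
  relabelling.\<close>

lemma disjoint_family_on_image:
  assumes "disjoint_family_on Q S" "\<And>s. s \<in> S \<Longrightarrow> Q s \<subseteq> A" "inj_on g A"
  shows "disjoint_family_on (\<lambda>s. g ` Q s) S"
  unfolding disjoint_family_on_def
proof (intro ballI impI)
  fix s t assume st: "s \<in> S" "t \<in> S" "s \<noteq> t"
  then have "Q s \<inter> Q t = {}" using assms(1) by (simp add: disjoint_family_on_def)
  then show "g ` Q s \<inter> g ` Q t = {}"
    using inj_on_image_Int[OF assms(3) assms(2)[OF st(1)] assms(2)[OF st(2)]] by simp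
qed

section \<open>A KTS(9) with one prescribed parallel class\<close>

lemma partition_on_set_lists:
  assumes "distinct (concat ps)" "set (concat ps) = V" "[] \<notin> set ps"
  shows "partition_on V (set ` set ps)"
proof (rule partition_onI)
  show "\<Union> (set ` set ps) = V" using assms(2) by simp
  show "{} \<notin> set ` set ps" using assms(3) by auto
  fix p q assume "p \<in> set ` set ps" "q \<in> set ` set ps" "p \<noteq> q"
  then show "disjnt p q"
    using assms(1) by (auto simp: distinct_concat_iff disjnt_def)
qed

text \<open>Turns unique existence into an equation between numbers, which evaluation can decide for
  each pair of points of an explicit block list.\<close>

lemma ex1_if_length_filter:
  assumes "length (filter P xs) = 1"
  shows "\<exists>!x. x \<in> set xs \<and> P x"
proof -
  obtain b where "filter P xs = [b]"
    using assms by (auto simp: length_Suc_conv)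
  then have "set (filter P xs) = {b}" by simp
  then have "x \<in> set xs \<and> P x \<longleftrightarrow> x = b" for x by auto
  then show ?thesis by simp
qed

text \<open>The affine plane of order 3, as the list of its parallel classes.\<close>

definition kts9 :: "nat list list list" where
  "kts9 = [[[0,3,6],[1,4,7],[2,5,8]], [[0,4,8],[1,5,6],[2,3,7]],
           [[0,5,7],[1,3,8],[2,4,6]], [[0,1,2],[3,4,5],[6,7,8]]]"

lemma kts9_list_block:
  assumes "x < 9" "y < 9" "x \<noteq> y"
  shows "\<exists>!b. b \<in> set (concat kts9) \<and> x \<in> set b \<and> y \<in> set b"
proof -
  have "list_all (\<lambda>x. list_all (\<lambda>y. x \<noteq> y \<longrightarrow>
          length (filter (\<lambda>b. List.member b x \<and> List.member b y) (concat kts9)) = 1) [0..<9]) [0..<9]"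
    by code_simp
  then have "length (filter (\<lambda>b. x \<in> set b \<and> y \<in> set b) (concat kts9)) = 1"
    using assms by (simp add: list_all_iff)
  then show ?thesis by (rule ex1_if_length_filter)
qed

text \<open>The class with index 3 is singled out because it consists of three intervals: a
  relabelling can then be assembled from one bijection per interval.\<close>

lemma kts9_nat:
  "\<exists>Q :: nat \<Rightarrow> nat set set.
    steiner_triple_system 9 {..<9} (\<Union>s<4. Q s) \<and>
    (\<forall>s<4. partition_on {..<9} (Q s)) \<and> disjoint_family_on Q {..<4} \<and>
    Q 3 = {{0..<3}, {3..<6}, {6..<9}}"
proof (intro exI conjI allI impI)
  define Q where "Q s = set ` set (kts9 ! s)" for s
  have len: "length kts9 = 4" by (simp add: kts9_def)
  have block: "length b = 3 \<and> distinct b \<and> set b \<subseteq> {..<9}" if "b \<in> set (concat kts9)" for b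
    using that by (auto simp: kts9_def)
  have union: "(\<Union>s<4. Q s) = set ` set (concat kts9)"
    unfolding Q_def by (simp add: kts9_def lessThan_Suc numeral_eq_Suc)
  \<comment> \<open>Two block lists with the same point set share two distinct points, hence are the
    same list by uniqueness. So disjointness of the classes may be checked on lists and passed on to
    sets.\<close>
  have inj: "inj_on set (set (concat kts9))"
  proof
    fix b c assume bc: "b \<in> set (concat kts9)" "c \<in> set (concat kts9)" "set b = set c"
    obtain x y zs where b: "b = x # y # zs"
      using block[OF bc(1)] by (auto simp: numeral_3_eq_3 length_Suc_conv)
    then have xy: "x < 9" "y < 9" "x \<noteq> y" using block[OF bc(1)] by auto
    have "x \<in> set b" "y \<in> set b" "x \<in> set c" "y \<in> set c" using b bc(3) by auto
    then show "b = c" using kts9_list_block[OF xy] bc(1,2) by blast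
  qed
  show "Q 3 = {{0..<3}, {3..<6}, {6..<9}}"
    by (auto simp: Q_def kts9_def numeral_eq_Suc atLeastLessThanSuc)
  show "partition_on {..<9} (Q s)" if "s < 4" for s
    unfolding Q_def
  proof (rule partition_on_set_lists)
    \<comment> \<open>Sorting to \<open>[0..<9]\<close> is the computable form of covering all nine
      points.\<close>
    have "list_all (\<lambda>ps. distinct (concat ps) \<and> sort (concat ps) = [0..<9] \<and> [] \<notin> set ps) kts9"
      by code_simp
    then have *: "distinct (concat (kts9 ! s)) \<and> sort (concat (kts9 ! s)) = [0..<9] \<and> [] \<notin> set (kts9 ! s)"
      using that len by (simp add: list_all_length)
    then show "distinct (concat (kts9 ! s))" "[] \<notin> set (kts9 ! s)" by auto
    show "set (concat (kts9 ! s)) = {..<9}"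
      using * by (metis set_sort set_upt atLeast_upt)
  qed
  have "list_all (\<lambda>s. list_all (\<lambda>t. s \<noteq> t \<longrightarrow>
          list_all (\<lambda>b. \<not> List.member (kts9 ! t) b) (kts9 ! s)) [0..<4]) [0..<4]"
    by code_simp
  then have "disjoint_family_on (\<lambda>s. set (kts9 ! s)) {..<4}"
    by (auto simp: disjoint_family_on_def list_all_iff)
  then show "disjoint_family_on Q {..<4}"
    unfolding Q_def
    by (rule disjoint_family_on_image[OF _ _ inj])
      (auto simp: len intro!: bexI[OF _ nth_mem])
  have "\<exists>!c. c \<in> set ` set (concat kts9) \<and> x \<in> c \<and> y \<in> c" if "x < 9" "y < 9" "x \<noteq> y" for x y
    using kts9_list_block[OF that] by blast
  then show "steiner_triple_system 9 {..<9} (\<Union>s<4. Q s)"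
    unfolding union steiner_triple_system_def using block by (auto simp: distinct_card)
qed

text \<open>The affine plane is relabelled by a bijection that sends the three intervals of its last
  class to \<open>I\<close>, \<open>W\<close> and \<open>U\<close>; any bijections between the parts
  will do.\<close>

lemma kts9_with_class:
  assumes disj: "I \<inter> W = {}" "I \<inter> U = {}" "W \<inter> U = {}"
    and card: "card I = 3" "card W = 3" "card U = 3"
  obtains Q :: "nat \<Rightarrow> 'a set set"
  where "steiner_triple_system 9 (I \<union> W \<union> U) (\<Union>s<4. Q s)"
    and "\<And>s. s < 4 \<Longrightarrow> partition_on (I \<union> W \<union> U) (Q s)"
    and "disjoint_family_on Q {..<4}"
    and "Q 3 = {I, W, U}"
proof -
  obtain p where p: "bij_betw p {0..<3::nat} I"
    using card(1) by (metis card.infinite ex_bij_betw_nat_finite zero_neq_numeral)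
  obtain q where q: "bij_betw q {3..<6::nat} W"
    using card(2) finite_same_card_bij[of "{3..<6::nat}" W] card.infinite[of W] by fastforce
  obtain r where r: "bij_betw r {6..<9::nat} U"
    using card(3) finite_same_card_bij[of "{6..<9::nat}" U] card.infinite[of U] by fastforce
  define f where "f k = (if k < 3 then p k else if k < 6 then q k else r k)" for k
  have f: "bij_betw f {0..<3} I" "bij_betw f {3..<6} W" "bij_betw f {6..<9} U"
    using p q r
      bij_betw_cong[of "{0..<3}" f p I] bij_betw_cong[of "{3..<6}" f q W]
      bij_betw_cong[of "{6..<9}" f r U]
    by (simp_all add: f_def)
  have "{..<9} = {0..<3} \<union> {3..<6} \<union> {6..<9::nat}" by auto
  then have bij: "bij_betw f {..<9} (I \<union> W \<union> U)"
    using bij_betw_combine[OF bij_betw_combine[OF f(1,2)] f(3)] disj by (simp add: Int_Un_distrib2)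
  then have inj: "inj_on f {..<9}" and img: "f ` {..<9} = I \<union> W \<union> U"
    by (auto simp: bij_betw_def)
  obtain Q :: "nat \<Rightarrow> nat set set" where Q: "steiner_triple_system 9 {..<9} (\<Union>s<4. Q s)"
    "\<And>s. s < 4 \<Longrightarrow> partition_on {..<9} (Q s)" "disjoint_family_on Q {..<4}"
    "Q 3 = {{0..<3}, {3..<6}, {6..<9}}"
    using kts9_nat by blast
  show thesis
  proof
    show "steiner_triple_system 9 (I \<union> W \<union> U) (\<Union>s<4. (`) f ` Q s)"
      using steiner_triple_system_image[OF Q(1) inj] by (simp add: img image_UN)
    show "partition_on (I \<union> W \<union> U) ((`) f ` Q s)" if "s < 4" for s
      using partition_on_image[OF Q(2)[OF that] inj] by (simp add: img)
    show "disjoint_family_on (\<lambda>s. (`) f ` Q s) {..<4}"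
      by (rule disjoint_family_on_image[OF Q(3) _ inj_on_image_Pow[OF inj]])
        (use Q(2) in \<open>auto simp: partition_on_def\<close>)
    show "(`) f ` Q 3 = {I, W, U}"
      using f by (simp add: Q(4) bij_betw_def)
  qed
qed

section \<open>Elementary facts on 3-GDDs and frames, and their transport along injections\<close>

lemma three_gddD:
  assumes "three_gdd g u V G B"
  shows "finite V" "(\<Union>i<u. G i) = V" "disjoint_family_on G {..<u}"
    and "\<And>i. i < u \<Longrightarrow> card (G i) = g"
    and "\<And>b. b \<in> B \<Longrightarrow> b \<subseteq> V" "\<And>b. b \<in> B \<Longrightarrow> card b = 3"
    and "\<And>b i. b \<in> B \<Longrightarrow> i < u \<Longrightarrow> card (b \<inter> G i) \<le> 1"
    and "\<And>i j x y. i < u \<Longrightarrow> j < u \<Longrightarrow> i \<noteq> j \<Longrightarrow> x \<in> G i \<Longrightarrow> y \<in> G j \<Longrightarrow>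
      \<exists>!b. b \<in> B \<and> x \<in> b \<and> y \<in> b"
proof -
  note gdd = assms[unfolded three_gdd_def]
  show "finite V" "(\<Union>i<u. G i) = V" "disjoint_family_on G {..<u}"
    using gdd by simp_all
  show "card (G i) = g" if "i < u" for i
    using gdd that by (elim conjE) simp
  show "b \<subseteq> V" "card b = 3" if "b \<in> B" for b
    using gdd that by (elim conjE, blast)+
  show "card (b \<inter> G i) \<le> 1" if "b \<in> B" "i < u" for b i
    using gdd that by (elim conjE) blast
  show "\<exists>!b. b \<in> B \<and> x \<in> b \<and> y \<in> b"
    if "i < u" "j < u" "i \<noteq> j" "x \<in> G i" "y \<in> G j" for i j x y
  proof -
    have "\<forall>i<u. \<forall>j<u. i \<noteq> j \<longrightarrow> (\<forall>x\<in>G i. \<forall>y\<in>G j. \<exists>!b. b \<in> B \<and> x \<in> b \<and> y \<in> b)"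
      using gdd by (elim conjE)
    then show ?thesis using that by simp
  qed
qed

lemma three_gdd_subset:
  assumes "three_gdd g u V G B" "i < u"
  shows "G i \<subseteq> V"
  using three_gddD(2)[OF assms(1)] assms(2) by blast

lemma three_gdd_image:
  assumes gdd: "three_gdd g u V G B" and inj: "inj_on f V"
  shows "three_gdd g u (f ` V) (\<lambda>i. f ` G i) ((`) f ` B)"
proof -
  note V = three_gddD(1,2)[OF gdd] and disj = three_gddD(3)[OF gdd]
    and card_G = three_gddD(4)[OF gdd] and block = three_gddD(5-7)[OF gdd]
    and pair = three_gddD(8)[OF gdd]
  have GV: "G i \<subseteq> V" if "i < u" for i using V that by blast
  have card_image_V: "card (f ` X) = card X" if "X \<subseteq> V" for X
    using inj that by (meson card_image inj_on_subset)
  have mem: "f x \<in> f ` b \<longleftrightarrow> x \<in> b" if "b \<in> B" "x \<in> V" for b x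
    using inj block(1)[OF that(1)] that(2) by (simp add: inj_on_image_mem_iff)
  have "\<exists>!c. c \<in> (`) f ` B \<and> f x \<in> c \<and> f y \<in> c"
    if ij: "i < u" "j < u" "i \<noteq> j" "x \<in> G i" "y \<in> G j" for i j x y
  proof -
    obtain b where b: "b \<in> B" "x \<in> b" "y \<in> b"
      and uniq: "\<And>c. c \<in> B \<Longrightarrow> x \<in> c \<Longrightarrow> y \<in> c \<Longrightarrow> c = b"
      using pair[OF ij] by blast
    have xy: "x \<in> V" "y \<in> V" using ij GV by auto
    show ?thesis
    proof (rule ex1I[of _ "f ` b"])
      show "f ` b \<in> (`) f ` B \<and> f x \<in> f ` b \<and> f y \<in> f ` b" using b by blast
      fix c assume c: "c \<in> (`) f ` B \<and> f x \<in> c \<and> f y \<in> c"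
      then obtain d where "d \<in> B" "c = f ` d" by blast
      then show "c = f ` b" using mem[of d] c xy uniq[of d] by simp
    qed
  qed
  moreover have "disjoint_family_on (\<lambda>i. f ` G i) {..<u}"
    unfolding disjoint_family_on_def
    using disj GV inj by (auto simp: disjoint_family_on_def inj_on_image_Int[symmetric])
  moreover have "f ` b \<subseteq> f ` V \<and> card (f ` b) = 3 \<and> (\<forall>i<u. card (f ` b \<inter> f ` G i) \<le> 1)"
    if "b \<in> B" for b
  proof -
    have "card (f ` b \<inter> f ` G i) \<le> 1" if "i < u" for i
    proof -
      have "f ` b \<inter> f ` G i = f ` (b \<inter> G i)"
        using inj_on_image_Int[OF inj] block(1)[OF \<open>b \<in> B\<close>] GV[OF that] by simp
      moreover have "b \<inter> G i \<subseteq> V" using GV[OF that] by blast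
      ultimately show ?thesis using block(3)[OF \<open>b \<in> B\<close> that] card_image_V by metis
    qed
    then show ?thesis using block(1,2)[OF that] card_image_V by (simp add: image_mono)
  qed
  moreover have "(\<Union>i<u. f ` G i) = f ` V" using V(2) by blast
  ultimately show ?thesis
    unfolding three_gdd_def using V(1) card_G card_image_V GV by auto
qed

lemma kirkman_frame_image:
  assumes frame: "kirkman_frame h u V G B" and inj: "inj_on f V"
  shows "kirkman_frame h u (f ` V) (\<lambda>i. f ` G i) ((`) f ` B)"
proof -
  have gdd: "three_gdd h u V G B" using frame by (simp add: kirkman_frame_def)
  obtain R where R: "partition_on B R" "\<And>P. P \<in> R \<Longrightarrow> \<exists>i<u. partition_on (V - G i) P"
    using frame by (auto simp: kirkman_frame_def)
  note GV = three_gdd_subset[OF gdd]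
  have "B \<subseteq> Pow V" using three_gddD(5)[OF gdd] by blast
  \<comment> \<open>The classes are sets of blocks, so keeping them disjoint requires injectivity
    one level up, of the image map on blocks.\<close>
  then have "inj_on ((`) f) B"
    using inj by (meson inj_on_image_Pow inj_on_subset)
  then have "partition_on ((`) f ` B) ((`) ((`) f) ` R)"
    by (rule partition_on_image[OF R(1)])
  moreover have "\<exists>i<u. partition_on (f ` V - f ` G i) ((`) f ` P)" if "P \<in> R" for P
  proof -
    obtain i where i: "i < u" "partition_on (V - G i) P" using R(2) \<open>P \<in> R\<close> by blast
    have "partition_on (f ` (V - G i)) ((`) f ` P)"
      by (rule partition_on_image[OF i(2) inj_on_subset[OF inj]]) blast
    then show ?thesis
      using i(1) inj_on_image_set_diff[OF inj _ GV[OF i(1)], of V] by auto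
  qed
  ultimately show ?thesis
    using three_gdd_image[OF gdd inj] by (auto simp: kirkman_frame_def)
qed

lemma three_gdd_group_eqI:
  assumes "three_gdd g u V G B" "i < u" "j < u" "x \<in> G i" "x \<in> G j"
  shows "i = j"
  using disjoint_family_onD[OF three_gddD(3)[OF assms(1)], of i j] assms(2-) by blast

lemma three_gdd_block_group_le1:
  assumes "three_gdd g u V G B" "b \<in> B" "i < u" "x \<in> b" "y \<in> b" "x \<in> G i" "y \<in> G i"
  shows "x = y"
proof -
  have "finite b" "card (b \<inter> G i) \<le> 1"
    using three_gddD(6,7)[OF assms(1,2)] assms(3) by (simp_all add: card_ge_0_finite)
  then show ?thesis
    using card_le_Suc0_iff_eq[of "b \<inter> G i"] assms(4-) by auto
qed

lemma three_gdd_card: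
  assumes "three_gdd g u V G B"
  shows "card V = g * u"
proof -
  note V = three_gddD(2)[OF assms, symmetric] and fin = three_gddD(1)[OF assms]
  have "\<forall>i\<in>{..<u}. finite (G i)"
    using fin three_gdd_subset[OF assms] finite_subset by blast
  then have "card (\<Union>i\<in>{..<u}. G i) = (\<Sum>i<u. card (G i))"
    using three_gddD(3)[OF assms] by (intro card_UN_disjoint) (simp_all add: disjoint_family_on_def)
  then show ?thesis using three_gddD(4)[OF assms] V by simp
qed

section \<open>Filling the groups of a 3-GDD with Steiner triple systems\<close>

text \<open>A pair from two different groups is covered by \<open>B\<close>, a pair inside
  \<open>G i \<union> I\<close> with a point in \<open>G i\<close> by \<open>C i\<close>, and a pair
  inside \<open>I\<close> by \<open>D\<close>. Because \<open>D\<close> lies in every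
  \<open>C i\<close>, all the systems agree on \<open>I\<close> and no pair there is covered twice.
  For empty \<open>I\<close> and \<open>w = 0\<close> this is the plain filling of groups.\<close>

lemma steiner_fill_groups:
  assumes gdd: "three_gdd g u V G B" and IV: "I \<inter> V = {}"
    and stsI: "steiner_triple_system w I D"
    and sts: "\<And>i. i < u \<Longrightarrow> steiner_triple_system (g + w) (G i \<union> I) (C i)"
    and DC: "\<And>i. i < u \<Longrightarrow> D \<subseteq> C i"
  shows "steiner_triple_system (g * u + w) (V \<union> I) (B \<union> D \<union> (\<Union>i<u. C i))"
proof -
  define M where "M = B \<union> D \<union> (\<Union>i<u. C i)"
  note GV = three_gdd_subset[OF gdd]
  note V = three_gddD(2)[OF gdd, symmetric]
  have fin: "finite V" "finite I" "card I = w"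
    using three_gddD(1)[OF gdd] stsI by (auto simp: steiner_triple_system_def)
  note subB = three_gddD(5,6)[OF gdd]
  have subD: "b \<subseteq> I" "card b = 3" if "b \<in> D" for b
    using stsI that by (auto simp: steiner_triple_system_def)
  have subC: "b \<subseteq> G i \<union> I" "card b = 3" if "i < u" "b \<in> C i" for i b
    using sts[OF that(1)] that(2) by (auto simp: steiner_triple_system_def)
  have pairB: "\<exists>!b. b \<in> B \<and> x \<in> b \<and> y \<in> b"
    if "i < u" "j < u" "i \<noteq> j" "x \<in> G i" "y \<in> G j" for i j x y
    using three_gddD(8)[OF gdd that] .
  have pairC: "\<exists>!b. b \<in> C i \<and> x \<in> b \<and> y \<in> b"
    if "i < u" "x \<in> G i \<union> I" "y \<in> G i \<union> I" "x \<noteq> y" for i x y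
    using sts[OF that(1)] that(2-) unfolding steiner_triple_system_def by blast
  have pairD: "\<exists>!b. b \<in> D \<and> x \<in> b \<and> y \<in> b" if "x \<in> I" "y \<in> I" "x \<noteq> y" for x y
    using stsI that unfolding steiner_triple_system_def by blast
  \<comment> \<open>Only \<open>C i\<close> can cover such a pair: a block of \<open>B\<close> has
    no point of \<open>I\<close> and at most one of \<open>G i\<close>, a block of \<open>D\<close>
    avoids \<open>x\<close>, and a block of \<open>C j\<close> reaches \<open>G i\<close> only if
    \<open>j = i\<close>.\<close>
  have same: "\<exists>!b. b \<in> M \<and> x \<in> b \<and> y \<in> b"
    if i: "i < u" "x \<in> G i" "y \<in> G i \<union> I" "x \<noteq> y" for i x y
  proof -
    have x: "x \<in> V" "x \<notin> I" using GV[OF i(1)] i(2) IV by auto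
    have "b \<in> C i" if b: "b \<in> M" "x \<in> b" "y \<in> b" for b
      using b(1) unfolding M_def
    proof (elim UnE UN_E)
      assume "b \<in> B"
      then have "y \<in> G i" using subB b(3) IV i(3) by blast
      then show ?thesis
        using three_gdd_block_group_le1[OF gdd \<open>b \<in> B\<close> i(1) b(2,3) i(2)] i(4) by blast
    next
      assume "b \<in> D" then show ?thesis using subD b(2) x by blast
    next
      fix j assume j: "j \<in> {..<u}" "b \<in> C j"
      then have "x \<in> G j" using subC[of j b] b(2) x by auto
      then show ?thesis using three_gdd_group_eqI[OF gdd i(1) _ i(2)] j by auto
    qed
    moreover have "C i \<subseteq> M" using i(1) by (auto simp: M_def)
    moreover have "\<exists>!b. b \<in> C i \<and> x \<in> b \<and> y \<in> b" using pairC[of i x y] i by blast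
    ultimately show ?thesis by (metis subsetD)
  qed
  have diff: "\<exists>!b. b \<in> M \<and> x \<in> b \<and> y \<in> b"
    if ij: "i < u" "j < u" "i \<noteq> j" "x \<in> G i" "y \<in> G j" for i j x y
  proof -
    have xy: "x \<in> V" "y \<in> V" "x \<notin> I" "y \<notin> I" using ij GV IV by blast+
    have "b \<in> B" if b: "b \<in> M" "x \<in> b" "y \<in> b" for b
      using b(1) unfolding M_def
    proof (elim UnE UN_E)
      assume "b \<in> D" then show ?thesis using subD b(2) xy by blast
    next
      fix k assume k: "k \<in> {..<u}" "b \<in> C k"
      then have "x \<in> G k" "y \<in> G k" using subC[of k b] b(2,3) xy by auto
      then show ?thesis
        using three_gdd_group_eqI[OF gdd] ij k(1) by (metis lessThan_iff)
    qed
    moreover have "B \<subseteq> M" by (auto simp: M_def)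
    ultimately show ?thesis using pairB[OF ij] by (metis subsetD)
  qed
  have inner: "\<exists>!b. b \<in> M \<and> x \<in> b \<and> y \<in> b" if xy: "x \<in> I" "y \<in> I" "x \<noteq> y" for x y
  proof -
    have "b \<in> D" if b: "b \<in> M" "x \<in> b" "y \<in> b" for b
      using b(1) unfolding M_def
    proof (elim UnE UN_E)
      assume "b \<in> B" then show ?thesis using subB b(2) xy IV by blast
    next
      fix k assume k: "k \<in> {..<u}" "b \<in> C k"
      then show ?thesis
        \<comment> \<open>The \<open>D\<close>-block through the pair also belongs to
          \<open>C k\<close>, where the block through the pair is unique, so \<open>b\<close> is
          that block.\<close>
        using pairC[of k x y] pairD[OF xy] DC[of k] b xy by blast
    qed
    moreover have "D \<subseteq> M" by (auto simp: M_def)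
    ultimately show ?thesis using pairD[OF xy] by (metis subsetD)
  qed
  have "\<exists>!b. b \<in> M \<and> x \<in> b \<and> y \<in> b" if xy: "x \<in> V \<union> I" "y \<in> V \<union> I" "x \<noteq> y" for x y
  proof (cases "x \<in> I")
    case True
    show ?thesis
    proof (cases "y \<in> I")
      case False
      then obtain j where "j < u" "y \<in> G j" using xy V by blast
      then have "\<exists>!b. b \<in> M \<and> y \<in> b \<and> x \<in> b" by (intro same) (use True xy(3) in auto)
      then show ?thesis by (simp add: conj_commute)
    next
      case yI: True
      show ?thesis using inner[OF True yI xy(3)] .
    qed
  next
    case False
    then obtain i where i: "i < u" "x \<in> G i" using xy V by blast
    show ?thesis
    proof (cases "y \<in> G i \<union> I")
      case True
      then show ?thesis using same[OF i _ xy(3)] by simp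
    next
      case False
      then obtain j where j: "j < u" "y \<in> G j" using xy V by blast
      then have "i \<noteq> j" using False by blast
      then show ?thesis using diff[OF i(1) j(1) _ i(2) j(2)] by simp
    qed
  qed
  moreover have "card (V \<union> I) = g * u + w"
    using fin IV three_gdd_card[OF gdd] by (simp add: card_Un_disjoint Int_commute)
  moreover have "b \<subseteq> V \<union> I \<and> card b = 3" if "b \<in> M" for b
    using that unfolding M_def
  proof (elim UnE UN_E)
    fix i assume "i \<in> {..<u}" "b \<in> C i"
    then show ?thesis using subC[of i b] GV[of i] by auto
  qed (use subB subD in blast)+
  ultimately have "steiner_triple_system (g * u + w) (V \<union> I) M"
    using fin by (simp add: steiner_triple_system_def)
  then show ?thesis by (simp add: M_def)
qed

section \<open>Counting the partial parallel classes that miss a group\<close>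

text \<open>Removing \<open>x\<close> from the blocks through it leaves pairs that partition
  \<open>V - G i\<close>, a set of \<open>g * (u - 1)\<close> points. The factor 2 on the left
  avoids division.\<close>

lemma three_gdd_degree:
  assumes gdd: "three_gdd g u V G B" and i: "i < u" and x: "x \<in> G i"
  shows "2 * card {b \<in> B. x \<in> b} = g * (u - 1)"
proof -
  let ?S = "{b \<in> B. x \<in> b}"
  note fin = three_gddD(1)[OF gdd] and V = three_gddD(2)[OF gdd, symmetric]
  have xV: "x \<in> V" using i x V by blast
  note subB = three_gddD(5,6)[OF gdd]
  have pairB: "\<exists>!b. b \<in> B \<and> x \<in> b \<and> y \<in> b" if "j < u" "i \<noteq> j" "y \<in> G j" for j y
    using three_gddD(8)[OF gdd i _ _ x] that .
  have "finite ?S" using fin subB by (auto intro!: finite_subset[of _ "Pow V"])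
  have out: "\<exists>j<u. i \<noteq> j \<and> y \<in> G j" if "b \<in> ?S" "y \<in> b" "y \<noteq> x" for b y
    using three_gdd_block_group_le1[OF gdd, of b i x y] that i x subB(1)[of b] V by blast
  have "card (\<Union>b\<in>?S. b - {x}) = (\<Sum>b\<in>?S. card (b - {x}))"
  proof (rule card_UN_disjoint[OF \<open>finite ?S\<close>])
    show "\<forall>b\<in>?S. finite (b - {x})" using subB fin finite_subset by blast
    show "\<forall>b\<in>?S. \<forall>c\<in>?S. b \<noteq> c \<longrightarrow> (b - {x}) \<inter> (c - {x}) = {}"
      using out pairB by blast
  qed
  also have "\<dots> = (\<Sum>b\<in>?S. 2)"
    using subB by (intro sum.cong) auto
  also have "(\<Union>b\<in>?S. b - {x}) = V - G i"
  proof
    show "(\<Union>b\<in>?S. b - {x}) \<subseteq> V - G i"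
      using subB three_gdd_block_group_le1[OF gdd _ i] x by blast
    show "V - G i \<subseteq> (\<Union>b\<in>?S. b - {x})"
    proof
      fix y assume y: "y \<in> V - G i"
      then obtain j where "j < u" "i \<noteq> j" "y \<in> G j" using V by blast
      then obtain b where "b \<in> B" "x \<in> b" "y \<in> b" using pairB by blast
      then show "y \<in> (\<Union>b\<in>?S. b - {x})" using x y by blast
    qed
  qed
  also have "card (V - G i) = g * u - g"
    using three_gdd_card[OF gdd] three_gdd_subset[OF gdd i] fin gdd i
    by (simp add: card_Diff_subset finite_subset three_gddD(4)[OF gdd i])
  finally show ?thesis by (simp add: diff_mult_distrib2)
qed

text \<open>The classes \<open>P i s\<close> are empty if there is a single group: the partial parallel class is then
  a partition of the empty set, which cannot be a part of the partition of the blocks.\<close>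

lemma kirkman_frame_classes:
  fixes h :: nat
  assumes frame: "kirkman_frame (2 * h) u V G B"
  obtains P where "\<And>i s. i < u \<Longrightarrow> s < h \<Longrightarrow> partition_on (V - G i) (P i s)"
    and "B = (\<Union>i<u. \<Union>s<h. P i s)"
    and "\<And>i j s t b. i < u \<Longrightarrow> j < u \<Longrightarrow> s < h \<Longrightarrow> t < h \<Longrightarrow> b \<in> P i s \<Longrightarrow> b \<in> P j t \<Longrightarrow>
      i = j \<and> s = t"
proof -
  have gdd: "three_gdd (2 * h) u V G B" using frame by (simp add: kirkman_frame_def)
  note fin = three_gddD(1)[OF gdd] and V = three_gddD(2)[OF gdd, symmetric]
    and card_G = three_gddD(4)[OF gdd]
  note subB = three_gddD(5,6)[OF gdd]
  have finB: "finite B" using fin subB by (auto intro!: finite_subset[of _ "Pow V"])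
  obtain R where R: "partition_on B R" "\<And>P. P \<in> R \<Longrightarrow> \<exists>i<u. partition_on (V - G i) P"
    using frame by (auto simp: kirkman_frame_def)
  have finR: "finite R" using finite_elements[OF finB R(1)] .
  show thesis
  proof (cases "u \<ge> 2 \<and> h > 0")
    \<comment> \<open>In the degenerate cases (\<open>h = 0\<close>, or at most one group) every
      group equals \<open>V\<close>. A block would then lie inside a group, so there are no blocks
      and empty classes suffice.\<close>
    case False
    have VG: "V = G i" if "i < u" for i
    proof (cases "h = 0")
      case True
      then have "G j = {}" if "j < u" for j
        using card_G[OF that] three_gdd_subset[OF gdd that] fin finite_subset by fastforce
      then show ?thesis using V that by auto
    next
      assume "h \<noteq> 0"
      then have "u = 1" using False that by auto
      then show ?thesis using V that by (auto simp: lessThan_Suc)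
    qed
    have "B = {}"
    proof (rule ccontr)
      assume "B \<noteq> {}"
      then obtain b where b: "b \<in> B" by blast
      then have "b \<noteq> {}" using subB(2)[OF b] by auto
      then obtain i where i: "i < u" using subB(1)[OF b] V by blast
      note three_gddD(7)[OF gdd b i]
      moreover have "b \<inter> G i = b" using VG[OF i] subB(1)[OF b] by blast
      ultimately show False using subB(2)[OF b] by simp
    qed
    then show thesis
      using VG by (intro that[of "\<lambda>_ _. {}"]) (auto simp: partition_on_empty)
  next
    case True
    \<comment> \<open>\<open>H i\<close> collects the classes that miss \<open>G i\<close>. As the
      groups are nonempty and disjoint, the complement covered by a class determines
      \<open>i\<close>, so the \<open>H i\<close> partition \<open>R\<close>.\<close>
    define H where "H i = {P \<in> R. partition_on (V - G i) P}" for i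
    have finH: "finite (H i)" for i using finR by (simp add: H_def)
    have H_unique: "i = j" if "i < u" "j < u" "P \<in> H i" "P \<in> H j" for i j P
    proof -
      have "V - G i = V - G j" using that(3,4) by (auto simp: H_def partition_on_def)
      then have "G i = G j" using three_gdd_subset[OF gdd] that(1,2) by blast
      moreover have "G i \<noteq> {}" using card_G[OF that(1)] True by auto
      ultimately show ?thesis using three_gdd_group_eqI[OF gdd that(1,2)] by blast
    qed
    have R_H: "R = (\<Union>i<u. H i)" using R(2) by (auto simp: H_def)
    have card_R: "card R = (\<Sum>i<u. card (H i))"
      unfolding R_H using finH H_unique by (intro card_UN_disjoint) blast+
    \<comment> \<open>Double counting at a point \<open>x\<close> of \<open>G i\<close>: each class
      outside \<open>H i\<close> has exactly one block through \<open>x\<close>, and each class in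
      \<open>H i\<close> has none. Hence \<open>card R - card (H i)\<close> is the degree
      \<open>h * (u - 1)\<close> of \<open>x\<close>.\<close>
    have miss: "card (H i) + h * (u - 1) = card R" if i: "i < u" for i
    proof -
      obtain x where x: "x \<in> G i" using card_G[OF i] True by fastforce
      have one: "card {b \<in> P. x \<in> b} = 1" if P: "P \<in> R - H i" for P
      proof -
        obtain j where j: "j < u" "partition_on (V - G j) P" using R(2) P by blast
        then have "j \<noteq> i" using P by (auto simp: H_def)
        then have "x \<in> V - G j"
          using x i j(1) V three_gdd_group_eqI[OF gdd i j(1)] by blast
        then obtain b where b: "b \<in> P" "x \<in> b" using partition_onD1[OF j(2)] by blast
        then have "{b \<in> P. x \<in> b} = {b}"
          using partition_onD2[OF j(2)] by (auto dest: disjointD)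
        then show ?thesis by simp
      qed
      have none: "{b \<in> P. x \<in> b} = {}" if "P \<in> H i" for P
        using that x by (auto simp: H_def partition_on_def)
      have "{b \<in> B. x \<in> b} = (\<Union>P\<in>R - H i. {b \<in> P. x \<in> b})"
        using partition_onD1[OF R(1)] none by blast
      moreover have "card (\<Union>P\<in>R - H i. {b \<in> P. x \<in> b}) = (\<Sum>P\<in>R - H i. card {b \<in> P. x \<in> b})"
      proof (rule card_UN_disjoint)
        show "finite (R - H i)" using finR by simp
        show "\<forall>P\<in>R - H i. finite {b \<in> P. x \<in> b}" using one by (metis card.infinite zero_neq_one)
        show "\<forall>P\<in>R - H i. \<forall>Q\<in>R - H i. P \<noteq> Q \<longrightarrow> {b \<in> P. x \<in> b} \<inter> {b \<in> Q. x \<in> b} = {}"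
          using partition_onD2[OF R(1)] by (auto dest: disjointD)
      qed
      ultimately have "card {b \<in> B. x \<in> b} = card (R - H i)" using one by simp
      moreover have "card {b \<in> B. x \<in> b} = h * (u - 1)"
        using three_gdd_degree[OF gdd i x] by simp
      moreover have "card (R - H i) = card R - card (H i)" "card (H i) \<le> card R"
        using finH finR by (auto simp: H_def card_Diff_subset intro: card_mono)
      ultimately show ?thesis by simp
    qed
    have card_H: "card (H i) = h" if "i < u" for i
    proof -
      \<comment> \<open>Summing the count over all groups gives
        \<open>card R + u * h * (u - 1) = u * card R\<close>. Cancelling \<open>u - 1 > 0\<close>
        yields \<open>card R = u * h\<close>, and then \<open>card (H i) = h\<close> for each
        group.\<close>
      have "(\<Sum>i<u. card (H i) + h * (u - 1)) = (\<Sum>i<u. card R)"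
        by (rule sum.cong) (use miss in auto)
      then have "card R + u * (h * (u - 1)) = u * card R"
        by (simp add: sum.distrib card_R[symmetric])
      moreover obtain m where m: "u = Suc m" "m > 0" using True by (cases u) auto
      ultimately have "m * card R = m * (u * h)" by (simp add: algebra_simps)
      then have "card R = u * h" using m(2) by simp
      then show ?thesis using miss[OF that] m(1) by (simp add: algebra_simps)
    qed
    have "\<forall>i. \<exists>e. i < u \<longrightarrow> bij_betw e {..<h} (H i)"
      using card_H finH by (metis ex_bij_betw_nat_finite lessThan_atLeast0)
    then obtain P where P: "\<And>i. i < u \<Longrightarrow> bij_betw (P i) {..<h} (H i)" by metis
    then have PH: "P i ` {..<h} = H i" if "i < u" for i using that by (simp add: bij_betw_def)
    show thesis
    proof (rule that)
      show "partition_on (V - G i) (P i s)" if "i < u" "s < h" for i s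
        using PH[OF that(1)] that(2) by (auto simp: H_def)
      have "B = (\<Union>i<u. \<Union>Q\<in>H i. Q)" using partition_onD1[OF R(1)] R_H by auto
      also have "\<dots> = (\<Union>i<u. \<Union>s<h. P i s)" by (simp add: PH[symmetric])
      finally show "B = (\<Union>i<u. \<Union>s<h. P i s)" .
      fix i j s t b
      assume *: "i < u" "j < u" "s < h" "t < h" "b \<in> P i s" "b \<in> P j t"
      \<comment> \<open>A block lies in only one part of \<open>R\<close>, so the two classes
        coincide; \<open>H_unique\<close> then identifies the groups, and injectivity of
        \<open>P i\<close> the positions.\<close>
      have mem: "P i s \<in> H i" "P j t \<in> H j" using PH * by auto
      then have "P i s = P j t"
        using partition_onD2[OF R(1)] *(5,6) by (auto simp: H_def dest: disjointD)
      moreover from this have "i = j" using H_unique[OF *(1,2)] mem by simp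
      ultimately show "i = j \<and> s = t"
        using P[OF *(1)] *(3,4) by (auto simp: bij_betw_def inj_on_def)
    qed
  qed
qed

section \<open>Filling the frame and resolving the resulting system\<close>

lemma partition_on_Un:
  assumes "partition_on A P" "partition_on B Q" "A \<inter> B = {}"
  shows "partition_on (A \<union> B) (P \<union> Q)"
  using assms disjoint_union[of P Q] by (auto simp: partition_on_def)

lemma kirkman_fill_frame:
  assumes frame: "kirkman_frame 6 n V G B" and sub: "gdd_subdesign 3 n W A G B"
    and "n > 0" and I: "card I = 3" and IV: "I \<inter> V = {}"
  shows "\<exists>B' A'. kirkman_triple_system (6 * n + 3) (V \<union> I) B' \<and>
    sts_subdesign (3 * n) (\<Union>i<n. W i) A' (V \<union> I) B'"
proof -
  have gdd: "three_gdd 6 n V G B" using frame by (simp add: kirkman_frame_def)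
  have gddW: "three_gdd 3 n (\<Union>i<n. W i) W A" and WG: "\<And>i. i < n \<Longrightarrow> W i \<subseteq> G i" and AB: "A \<subseteq> B"
    using sub by (auto simp: gdd_subdesign_def)
  note finV = three_gddD(1)[OF gdd] and V = three_gddD(2)[OF gdd, symmetric]
  note GV = three_gdd_subset[OF gdd]
  have finI: "finite I" using I by (simp add: card_ge_0_finite)
  have "kirkman_frame (2 * 3) n V G B" using frame by simp
  then obtain P :: "nat \<Rightarrow> nat \<Rightarrow> 'a set set"
    where P: "\<And>i s. i < n \<Longrightarrow> s < 3 \<Longrightarrow> partition_on (V - G i) (P i s)"
    "B = (\<Union>i<n. \<Union>s<3. P i s)"
    "\<And>i j s t b. i < n \<Longrightarrow> j < n \<Longrightarrow> s < 3 \<Longrightarrow> t < 3 \<Longrightarrow> b \<in> P i s \<Longrightarrow> b \<in> P j t \<Longrightarrow> i = j \<and> s = t"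
    by (elim kirkman_frame_classes) blast
  \<comment> \<open>One predicate for all properties of the KTS(9) on \<open>G i \<union> I\<close>
    allows a single choice of \<open>Q\<close> for all groups at once.\<close>
  define local_kts where "local_kts i Q \<longleftrightarrow>
    steiner_triple_system 9 (G i \<union> I) (\<Union>s<4. Q s) \<and>
    (\<forall>s<4. partition_on (G i \<union> I) (Q s)) \<and> disjoint_family_on Q {..<4} \<and>
    Q 3 = {I, W i, G i - W i}" for i and Q :: "nat \<Rightarrow> 'a set set"
  have "\<exists>Q. local_kts i Q" if i: "i < n" for i
  proof -
    note [simp] = three_gddD(4)[OF gdd i] three_gddD(4)[OF gddW i]
    then have "card (G i - W i) = 3"
      using WG[OF i] by (simp add: card_Diff_subset card_ge_0_finite)
    moreover have "I \<inter> W i = {}" "I \<inter> (G i - W i) = {}" "I \<union> W i \<union> (G i - W i) = G i \<union> I"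
      using IV GV[OF i] WG[OF i] by auto
    ultimately show ?thesis
      using kts9_with_class[of I "W i" "G i - W i"] I three_gddD(4)[OF gddW i]
      unfolding local_kts_def by (metis Diff_disjoint)
  qed
  then obtain Q where "\<And>i. i < n \<Longrightarrow> local_kts i (Q i)" by metis
  then have stsQ: "\<And>i. i < n \<Longrightarrow> steiner_triple_system 9 (G i \<union> I) (\<Union>s<4. Q i s)"
    and partQ: "\<And>i s. i < n \<Longrightarrow> s < 4 \<Longrightarrow> partition_on (G i \<union> I) (Q i s)"
    and disjQ: "\<And>i. i < n \<Longrightarrow> disjoint_family_on (Q i) {..<4}"
    and Q3: "\<And>i. i < n \<Longrightarrow> Q i 3 = {I, W i, G i - W i}"
    unfolding local_kts_def by blast+
  define C where "C i = (\<Union>s<4. Q i s)" for i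
  define B' where "B' = B \<union> {I} \<union> (\<Union>i<n. C i)"
  \<comment> \<open>These are the parallel classes of the final system: \<open>K i s\<close> extends
    a partial class missing \<open>G i\<close> by a class on \<open>G i \<union> I\<close>, giving
    \<open>3 * n\<close> classes, and \<open>T\<close> joins the remaining local classes, which all
    share the block \<open>I\<close>.\<close>
  define T where "T = (\<Union>i<n. Q i 3)"
  define K where "K i s = P i s \<union> Q i s" for i s
  define R where "R = insert T {K i s | i s. i < n \<and> s < 3}"
  have sub3: "{..<4} = insert 3 {..<3::nat}" by auto
  have blockC: "b \<subseteq> G i \<union> I" "card b = 3" if "i < n" "b \<in> C i" for i b
    using stsQ[OF that(1)] that(2) by (auto simp: steiner_triple_system_def C_def)
  have IC: "I \<in> C i" if "i < n" for i using Q3[OF that] by (auto simp: C_def sub3)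
  have "steiner_triple_system 3 I {I}"
    using I finI by (auto simp: steiner_triple_system_def)
  then have sts: "steiner_triple_system (6 * n + 3) (V \<union> I) B'"
    unfolding B'_def using stsQ IC
    by (intro steiner_fill_groups[OF gdd IV]) (auto simp: C_def)
  \<comment> \<open>A frame block avoids \<open>I\<close>, so as a block of \<open>C i\<close> it
    would have all three points in \<open>G i\<close>, where it may have at most one.\<close>
  have BC: False if "i < n" "b \<in> B" "b \<in> C i" for i b
  proof -
    have "b \<subseteq> V" "card (b \<inter> G i) \<le> 1" using three_gddD(5,7)[OF gdd] that by auto
    moreover have "b \<subseteq> G i" using blockC[OF that(1,3)] \<open>b \<subseteq> V\<close> IV by blast
    ultimately show False using blockC(2)[OF that(1,3)] by (simp add: Int_absorb2)
  qed
  \<comment> \<open>The bounds differ on purpose: \<open>t = 3\<close> compares a class used in some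
    \<open>K i s\<close> with \<open>T\<close>. A block common to two groups' systems lies in
    \<open>I\<close>, hence equals \<open>I\<close>, which belongs to class 3 and so not to class
    \<open>s < 3\<close>.\<close>
  have QQ: "i = j \<and> s = t" if *: "i < n" "j < n" "s < 3" "t < 4" "b \<in> Q i s" "b \<in> Q j t" for i j s t b
  proof -
    have bC: "b \<in> C i" "b \<in> C j" using * by (auto simp: C_def)
    have same: "s = t" if "b \<in> Q i t" "t < 4" for t
      using disjoint_family_onD[OF disjQ[OF *(1)], of s t] *(3,5) that by auto
    have "i = j"
    proof (rule ccontr)
      assume "i \<noteq> j"
      then have "b \<subseteq> I"
        using blockC(1)[OF *(1) bC(1)] blockC(1)[OF *(2) bC(2)]
          three_gdd_group_eqI[OF gdd *(1,2)] by blast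
      then have "b = I" using blockC(2)[OF *(1) bC(1)] I finI by (simp add: card_subset_eq)
      then show False using same[of 3] Q3[OF *(1)] *(3) by simp
    qed
    then show ?thesis using same *(4,6) by blast
  qed
  have PB: "b \<in> B" if "b \<in> P i s" "i < n" "s < 3" for b i s using P(2) that by blast
  have QC: "b \<in> C i" if "b \<in> Q i s" "s < 4" for b i s using that by (auto simp: C_def)
  have KK: "i = j \<and> s = t" if "i < n" "j < n" "s < 3" "t < 3" "b \<in> K i s" "b \<in> K j t" for i j s t b
    using that(5,6) unfolding K_def
  proof (elim UnE)
    assume "b \<in> P i s" "b \<in> P j t" then show ?thesis by (rule P(3)[OF that(1-4)])
  next
    assume "b \<in> P i s" "b \<in> Q j t"
    then have "b \<in> B" "b \<in> C j" using PB QC that by auto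
    then show ?thesis using BC that(2) by blast
  next
    assume "b \<in> Q i s" "b \<in> P j t"
    then have "b \<in> B" "b \<in> C i" using PB QC that by auto
    then show ?thesis using BC that(1) by blast
  next
    assume "b \<in> Q i s" "b \<in> Q j t"
    then show ?thesis using QQ[OF that(1-3), of t b] that(4) by simp
  qed
  have KT: "K i s \<inter> T = {}" if "i < n" "s < 3" for i s
  proof -
    have False if b: "b \<in> K i s" "b \<in> T" for b
    proof -
      obtain j where j: "j < n" "b \<in> Q j 3" using b(2) by (auto simp: T_def)
      from b(1) show False
        unfolding K_def
      proof
        assume "b \<in> P i s"
        then have "b \<in> B" "b \<in> C j" using PB QC j(2) \<open>i < n\<close> \<open>s < 3\<close> by auto
        then show False using BC j(1) by blast
      next
        assume "b \<in> Q i s"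
        then show False using QQ[OF \<open>i < n\<close> j(1) \<open>s < 3\<close> _ _ j(2)] \<open>s < 3\<close> by simp
      qed
    qed
    then show ?thesis by blast
  qed
  have parK: "partition_on (V \<union> I) (K i s)" if "i < n" "s < 3" for i s
  proof -
    have "(V - G i) \<inter> (G i \<union> I) = {}" "(V - G i) \<union> (G i \<union> I) = V \<union> I"
      using IV GV[OF that(1)] by auto
    then show ?thesis
      using partition_on_Un[OF P(1)[OF that] partQ[of i s]] that by (simp add: K_def)
  qed
  have parT: "partition_on (V \<union> I) T"
  proof (rule partition_onI)
    have "\<Union> (Q i 3) = G i \<union> I" if "i < n" for i
      using partition_onD1[OF partQ[OF that, of 3]] by simp
    then have "\<Union> T = (\<Union>i<n. G i \<union> I)" unfolding T_def by blast
    \<comment> \<open>At least one group is needed here, since \<open>I\<close> is covered only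
      through the local systems.\<close>
    then show "\<Union> T = V \<union> I" using V \<open>n > 0\<close> by auto
    show "{} \<notin> T" using partition_onD3[OF partQ[of _ 3]] by (auto simp: T_def)
    fix b c assume "b \<in> T" "c \<in> T" "b \<noteq> c"
    then obtain i j where ij: "i < n" "j < n" "b \<in> Q i 3" "c \<in> Q j 3" by (auto simp: T_def)
    \<comment> \<open>Within one group this is disjointness in a local class. Across groups, each
      block is either the common block \<open>I\<close> or lies inside its own group, and
      \<open>I\<close> counts only once because \<open>T\<close> is a set.\<close>
    show "disjnt b c"
    proof (cases "i = j")
      case True
      then show ?thesis
        using disjointD[OF partition_onD2[OF partQ[OF ij(1), of 3]], of b c] ij \<open>b \<noteq> c\<close>
        by (simp add: disjnt_def)
    next
      case False
      then have "G i \<inter> G j = {}" using three_gdd_group_eqI[OF gdd ij(1,2)] by blast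
      moreover have "b = I \<or> b \<subseteq> G i" using ij(3) Q3[OF ij(1)] WG[OF ij(1)] by auto
      moreover have "c = I \<or> c \<subseteq> G j" using ij(4) Q3[OF ij(2)] WG[OF ij(2)] by auto
      moreover have "G i \<inter> I = {}" "G j \<inter> I = {}" using GV[OF ij(1)] GV[OF ij(2)] IV by auto
      ultimately show ?thesis using \<open>b \<noteq> c\<close> unfolding disjnt_def by blast
    qed
  qed
  have parR: "partition_on (V \<union> I) S" if "S \<in> R" for S
    using that unfolding R_def by (elim insertE CollectE exE conjE) (simp_all add: parK parT)
  have "partition_on B' R"
  proof (rule partition_onI)
    have "\<Union> R = T \<union> (\<Union>i<n. \<Union>s<3. K i s)" by (auto simp: R_def)
    also have "\<dots> = B \<union> (\<Union>i<n. C i)" by (auto simp: K_def P(2) T_def C_def sub3)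
    also have "\<dots> = B'" using IC \<open>n > 0\<close> by (auto simp: B'_def)
    finally show "\<Union> R = B'" .
    \<comment> \<open>An empty class would have empty union, but every class covers
      \<open>I\<close>.\<close>
    have "I \<noteq> {}" using I by auto
    then show "{} \<notin> R" using partition_onD1[OF parR] by fastforce
    fix S S' assume "S \<in> R" "S' \<in> R" "S \<noteq> S'"
    moreover have "disjnt (K i s) (K j t)"
      if "i < n" "j < n" "s < 3" "t < 3" "K i s \<noteq> K j t" for i j s t
      unfolding disjnt_iff using KK[OF that(1-4)] that(5) by blast
    ultimately show "disjnt S S'"
      unfolding R_def using KT
      by (elim insertE CollectE exE conjE) (simp_all add: disjnt_def Int_commute)
  qed
  then have kts: "kirkman_triple_system (6 * n + 3) (V \<union> I) B'"
    using sts parR by (auto simp: kirkman_triple_system_def parallel_class_def)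
  \<comment> \<open>The filling lemma with no extra points: each group \<open>W i\<close> of the
    3-GDD has three points and is filled by the single block \<open>W i\<close>, which lies in
    \<open>Q i 3\<close>.\<close>
  have "steiner_triple_system (3 * n + 0) ((\<Union>i<n. W i) \<union> {}) (A \<union> {} \<union> (\<Union>i<n. {W i}))"
    using three_gddD(4)[OF gddW]
    by (intro steiner_fill_groups[OF gddW]) (auto simp: steiner_triple_system_def intro: card_ge_0_finite)
  moreover have "A \<union> (\<Union>i<n. {W i}) \<subseteq> B'"
    using AB Q3 by (auto simp: B'_def C_def sub3)
  moreover have "(\<Union>i<n. W i) \<subseteq> V \<union> I" using WG V by blast
  ultimately have "sts_subdesign (3 * n) (\<Union>i<n. W i) (A \<union> (\<Union>i<n. {W i})) (V \<union> I) B'"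
    by (simp add: sts_subdesign_def)
  then show ?thesis using kts by blast
qed

theorem theorem4p8:
  fixes n :: nat
  assumes "n > 0"
    and "\<exists>(V :: 'a set) G B W A.
           kirkman_frame 6 n V G B \<and> gdd_subdesign 3 n W A G B"
  shows "\<exists>(V :: nat set) B W A.
           kirkman_triple_system (6 * n + 3) V B \<and> sts_subdesign (3 * n) W A V B"
proof -
  obtain V :: "'a set" and G B W A
    where frame: "kirkman_frame 6 n V G B" and sub: "gdd_subdesign 3 n W A G B"
    using assms(2) by blast
  have gdd: "three_gdd 6 n V G B" using frame by (simp add: kirkman_frame_def)
  note GV = three_gdd_subset[OF gdd]
  \<comment> \<open>The type \<open>'a\<close> may have no three points outside \<open>V\<close>.
    Moving the frame to the initial segment below \<open>k\<close> of the natural numbers leaves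
    \<open>{k..<k + 3}\<close> free to serve as \<open>I\<close>.\<close>
  obtain f :: "'a \<Rightarrow> nat" and k where img: "f ` V = {i. i < k}" and inj: "inj_on f V"
    using finite_imp_inj_to_nat_seg[OF three_gddD(1)[OF gdd]] by metis
  have "(\<Union>i<n. W i) \<subseteq> V" using sub GV by (fastforce simp: gdd_subdesign_def)
  then have "three_gdd 3 n (f ` (\<Union>i<n. W i)) (\<lambda>i. f ` W i) ((`) f ` A)"
    using sub inj by (intro three_gdd_image) (auto simp: gdd_subdesign_def intro: inj_on_subset)
  then have "gdd_subdesign 3 n (\<lambda>i. f ` W i) ((`) f ` A) (\<lambda>i. f ` G i) ((`) f ` B)"
    using sub unfolding gdd_subdesign_def by (auto simp: image_UN image_mono)
  then show ?thesis
    using kirkman_fill_frame[OF kirkman_frame_image[OF frame inj] _ assms(1), of _ _ "{k..<k + 3}"]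
    by (fastforce simp: img)
qed
end
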